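(* Let $a,b,c,d\in\mathbb{R}$ with $a<b$ and $c<d$, let $\Delta:=[a,b]\times[c,d]$, and let $f:\Delta\to\mathbb{R}$ satisfy the following: (1) $\Delta$ contains no point of the form $(0,y)$ or $(x,0)$ (in particular not $(0,0)$). (2) For each fixed $y_0\in[c,d]$, the function given by $x\mapsto f(x,y_0)$ is continuous on $[a,b]$ and differentiable on $(a,b)$. (3) For each fixed $x_0\in[a,b]$, the function given by $y\mapsto f_x(x_0,y)$ is continuous on $[c,d]$ and differentiable on $(c,d)$. Then for all pairs $x_1,x_2\in(a,b)$ with $x_1\neq x_2$ and $y_1,y_2\in(c,d)$ with $y_1\neq y_2$, there exists $(\xi_1,\xi_2)$, with $\xi_1$ in the open interval with endpoints $x_1,x_2$ and $\xi_2$ in the open interval with endpoints $y_1,y_2$, such that $$\xi_1\xi_2\frac{\partial^2 f}{\partial t\partial s}(\xi_1,\xi_2)-\xi_1\frac{\partial f}{\partial t}(\xi_1,\xi_2)-\xi_2\frac{\partial f}{\partial s}(\xi_1,\xi_2)+f(\xi_1,\xi_2)$$ $$=\frac{x_2y_2f(x_1,y_1)-x_2y_1f(x_1,y_2)-x_1y_2f(x_2,y_1)+x_1y_1f(x_2,y_2)}{(x_2-x_1)(y_2-y_1)}.$$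
   Context: $f_x=\frac{\partial f}{\partial t}$ denotes the partial derivative of $f$ with respect to the first variable, $\frac{\partial f}{\partial s}$ the partial derivative with respect to the second variable, and $\frac{\partial^2 f}{\partial t\partial s}$ the mixed second-order partial derivative of $f$ with respect to the two variables.
   Formalization: It is additionally assumed that ∂f/∂s exists at every point of (a,b)×(c,d), since (1)–(3) do not imply it (f(x,y)=g(y) with g nowhere differentiable) and the conclusion uses it; f_x at x=a,b is read as a one-sided derivative. *)

theory Defs
  imports "HOL-Analysis.Analysis"
begin

text \<open>
  Partial derivatives of a function given on a set \<open>D\<close> of the plane. Each one is the derivative
  along the corresponding slice of \<open>D\<close>: at interior points this is the ordinary partial
  derivative, at boundary points of a rectangle it is the one-sided one. Values of \<open>f\<close> outside
  \<open>D\<close> are irrelevant. As usual, the values are meaningful only where the derivative exists.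
\<close>

definition partial_t ::
  "(real \<times> real) set \<Rightarrow> (real \<times> real \<Rightarrow> real) \<Rightarrow> real \<times> real \<Rightarrow> real" where
  "partial_t D f = (\<lambda>(x, y). vector_derivative (\<lambda>t. f (t, y)) (at x within {t. (t, y) \<in> D}))"

definition partial_s ::
  "(real \<times> real) set \<Rightarrow> (real \<times> real \<Rightarrow> real) \<Rightarrow> real \<times> real \<Rightarrow> real" where
  "partial_s D f = (\<lambda>(x, y). vector_derivative (\<lambda>s. f (x, s)) (at y within {s. (x, s) \<in> D}))"

text \<open>The first variable is differentiated first: the mixed derivative is the derivative of
  \<open>f\<^sub>x\<close> with respect to the second variable.\<close>

definition partial_ts ::
  "(real \<times> real) set \<Rightarrow> (real \<times> real \<Rightarrow> real) \<Rightarrow> real \<times> real \<Rightarrow> real" where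
  "partial_ts D f = partial_s D (partial_t D f)"

end

theory Submission
  imports Defs
begin

text \<open>
  The identity is Pompeiu's mean value theorem applied once in each variable. In one variable the
  theorem says that the chord of \<open>g\<close> through \<open>x1\<close> and \<open>x2\<close> meets the vertical axis at the same
  height as the tangent at some intermediate \<open>\<xi>\<close>, namely at \<open>g \<xi> - \<xi> * g' \<xi>\<close>
  (lemma \<open>pompeiu_mean_value\<close>).

  Taking the intercept of the chord is a linear operation on \<open>g\<close>, and the right-hand side of the
  claim is this operation performed in \<open>y\<close> and then in \<open>x\<close>. So let \<open>G x\<close> be the intercept of the
  chord of \<open>f (x, \<cdot>)\<close> through \<open>y1\<close> and \<open>y2\<close>. Pompeiu's theorem for \<open>G\<close> produces \<open>\<xi>1\<close>. By linearity
  \<open>G \<xi>1 - \<xi>1 * G' \<xi>1\<close> is again an intercept, that of the chord through \<open>y1\<close> and \<open>y2\<close> of the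
  function \<open>H y = f (\<xi>1, y) - \<xi>1 * partial_t \<Delta> f (\<xi>1, y)\<close>. Pompeiu's theorem for \<open>H\<close> produces
  \<open>\<xi>2\<close>, and \<open>H \<xi>2 - \<xi>2 * H' \<xi>2\<close> is the left-hand side of the claim. Since \<open>\<xi>1\<close> is fixed
  before \<open>\<xi>2\<close> is chosen, each step differentiates along a single slice only, and no joint
  regularity of \<open>f\<close> enters.
\<close>

text \<open>
  Cauchy's mean value theorem for \<open>g t / t\<close> and \<open>1 / t\<close>: the quotient of the increments of these
  two functions is the intercept of the chord, and the quotient of their derivatives is the
  intercept of the tangent. Both functions are differentiable because the interval avoids zero.
\<close>

lemma pompeiu_mean_value_less:
  fixes g g' :: "real \<Rightarrow> real"
  assumes "x1 < x2" and nz: "0 \<notin> {x1..x2}"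
    and deriv: "\<And>x. x \<in> {x1..x2} \<Longrightarrow> (g has_real_derivative g' x) (at x)"
  shows "\<exists>\<xi>. x1 < \<xi> \<and> \<xi> < x2 \<and> (x2 * g x1 - x1 * g x2) / (x2 - x1) = g \<xi> - \<xi> * g' \<xi>"
proof -
  have quot: "((\<lambda>t. g t / t) has_real_derivative (g' x * x - g x) / x\<^sup>2) (at x)"
    if "x \<in> {x1..x2}" for x
    using that nz by (auto intro!: derivative_eq_intros deriv simp: power2_eq_square)
  have recip: "((\<lambda>t. 1 / t) has_real_derivative - (1 / x\<^sup>2)) (at x)" if "x \<in> {x1..x2}" for x
    using that nz by (auto intro!: derivative_eq_intros simp: power2_eq_square)
  obtain \<xi> where \<xi>: "x1 < \<xi>" "\<xi> < x2"
    and cauchy: "(g x2 / x2 - g x1 / x1) * - (1 / \<xi>\<^sup>2) = (1 / x2 - 1 / x1) * ((g' \<xi> * \<xi> - g \<xi>) / \<xi>\<^sup>2)"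
    using GMVT'[OF \<open>x1 < x2\<close>, of "\<lambda>t. g t / t" "\<lambda>t. 1 / t" "\<lambda>x. - (1 / x\<^sup>2)" "\<lambda>x. (g' x * x - g x) / x\<^sup>2"]
      DERIV_isCont[OF quot] DERIV_isCont[OF recip] quot recip by auto
  have nonzero: "x1 \<noteq> 0" "x2 \<noteq> 0" "\<xi> \<noteq> 0" "x2 - x1 \<noteq> 0"
    using nz \<xi> \<open>x1 < x2\<close> by auto
  have "g x2 / x2 - g x1 / x1 = (1 / x2 - 1 / x1) * (g \<xi> - \<xi> * g' \<xi>)"
    using cauchy nonzero by (simp add: divide_simps) (simp add: algebra_simps)
  then have "x2 * g x1 - x1 * g x2 = (x2 - x1) * (g \<xi> - \<xi> * g' \<xi>)"
    using nonzero by (simp add: divide_simps) (simp add: algebra_simps)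
  then show ?thesis
    using \<xi> nonzero by (auto simp: divide_simps)
qed

lemma pompeiu_mean_value:
  fixes g g' :: "real \<Rightarrow> real"
  assumes "x1 \<noteq> x2" and "0 \<notin> closed_segment x1 x2"
    and "\<And>x. x \<in> closed_segment x1 x2 \<Longrightarrow> (g has_real_derivative g' x) (at x)"
  shows "\<exists>\<xi> \<in> open_segment x1 x2. (x2 * g x1 - x1 * g x2) / (x2 - x1) = g \<xi> - \<xi> * g' \<xi>"
proof (cases "x1 < x2")
  case True
  then show ?thesis
    using pompeiu_mean_value_less[of x1 x2 g g'] assms
    by (auto simp: open_segment_eq_real_ivl closed_segment_eq_real_ivl)
next
  case False
  then have "x2 < x1"
    using assms(1) by simp
  moreover have "(x2 * g x1 - x1 * g x2) / (x2 - x1) = (x1 * g x2 - x2 * g x1) / (x1 - x2)"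
    using minus_divide_divide[of "x1 * g x2 - x2 * g x1" "x1 - x2"] by simp
  ultimately show ?thesis
    using pompeiu_mean_value_less[of x2 x1 g g'] assms
    by (auto simp: open_segment_eq_real_ivl closed_segment_eq_real_ivl)
qed

text \<open>
  At an interior point of a slice, the derivative within the slice is the two-sided one, the form
  that the mean value theorem asks for.
\<close>

lemma partial_t_works:
  assumes "x \<in> {a<..<b}" "y \<in> {c..d}" "(\<lambda>t. f (t, y)) differentiable (at x)"
  shows "((\<lambda>t. f (t, y)) has_real_derivative partial_t ({a..b} \<times> {c..d}) f (x, y)) (at x)"
proof -
  have "{t. (t, y) \<in> {a..b} \<times> {c..d}} = {a..b}"
    using \<open>y \<in> {c..d}\<close> by auto
  then show ?thesis
    using assms by (simp add: partial_t_def at_within_Icc_at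
        vector_derivative_works[symmetric] has_real_derivative_iff_has_vector_derivative)
qed

lemma partial_s_works:
  assumes "x \<in> {a..b}" "y \<in> {c<..<d}" "(\<lambda>s. f (x, s)) differentiable (at y)"
  shows "((\<lambda>s. f (x, s)) has_real_derivative partial_s ({a..b} \<times> {c..d}) f (x, y)) (at y)"
proof -
  have "{s. (x, s) \<in> {a..b} \<times> {c..d}} = {c..d}"
    using \<open>x \<in> {a..b}\<close> by auto
  then show ?thesis
    using assms by (simp add: partial_s_def at_within_Icc_at
        vector_derivative_works[symmetric] has_real_derivative_iff_has_vector_derivative)
qed

theorem theorem6:
  fixes a b c d :: real
    and \<Delta> :: "(real \<times> real) set"
    and f :: "real \<times> real \<Rightarrow> real"
  assumes "a < b" and "c < d"
    and \<Delta>: "\<Delta> = {a..b} \<times> {c..d}"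
    and no_axis_point: "\<And>x y. (0, y) \<notin> \<Delta> \<and> (x, 0) \<notin> \<Delta>"
    and f_cont: "\<And>y0. y0 \<in> {c..d} \<Longrightarrow> continuous_on {a..b} (\<lambda>x. f (x, y0))"
    and f_diff: "\<And>y0. y0 \<in> {c..d} \<Longrightarrow> (\<lambda>x. f (x, y0)) differentiable_on {a<..<b}"
    and fx_exists: "\<And>x0 y0. x0 \<in> {a..b} \<Longrightarrow> y0 \<in> {c..d} \<Longrightarrow>
          (\<lambda>x. f (x, y0)) differentiable (at x0 within {a..b})"
    and fx_cont: "\<And>x0. x0 \<in> {a..b} \<Longrightarrow> continuous_on {c..d} (\<lambda>y. partial_t \<Delta> f (x0, y))"
    and fx_diff: "\<And>x0. x0 \<in> {a..b} \<Longrightarrow> (\<lambda>y. partial_t \<Delta> f (x0, y)) differentiable_on {c<..<d}"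
    and fs_exists: "\<And>x0. x0 \<in> {a<..<b} \<Longrightarrow> (\<lambda>y. f (x0, y)) differentiable_on {c<..<d}"
  shows "\<forall>x1 \<in> {a<..<b}. \<forall>x2 \<in> {a<..<b}. \<forall>y1 \<in> {c<..<d}. \<forall>y2 \<in> {c<..<d}.
    x1 \<noteq> x2 \<longrightarrow> y1 \<noteq> y2 \<longrightarrow>
    (\<exists>\<xi>1 \<in> open_segment x1 x2. \<exists>\<xi>2 \<in> open_segment y1 y2.
      \<xi>1 * \<xi>2 * partial_ts \<Delta> f (\<xi>1, \<xi>2) - \<xi>1 * partial_t \<Delta> f (\<xi>1, \<xi>2)
        - \<xi>2 * partial_s \<Delta> f (\<xi>1, \<xi>2) + f (\<xi>1, \<xi>2)
      = (x2 * y2 * f (x1, y1) - x2 * y1 * f (x1, y2)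
          - x1 * y2 * f (x2, y1) + x1 * y1 * f (x2, y2))
        / ((x2 - x1) * (y2 - y1)))"
proof (intro ballI impI)
  fix x1 x2 y1 y2
  assume x: "x1 \<in> {a<..<b}" "x2 \<in> {a<..<b}" "x1 \<noteq> x2"
    and y: "y1 \<in> {c<..<d}" "y2 \<in> {c<..<d}" "y1 \<noteq> y2"
  have xseg: "closed_segment x1 x2 \<subseteq> {a<..<b}" and yseg: "closed_segment y1 y2 \<subseteq> {c<..<d}"
    using x y by (simp_all add: closed_segment_subset)
  have nz: "0 \<notin> {a..b}" "0 \<notin> {c..d}"
    using no_axis_point[where x = a and y = c] \<open>a < b\<close> \<open>c < d\<close> unfolding \<Delta> by auto
  then have nz_seg: "0 \<notin> closed_segment x1 x2" "0 \<notin> closed_segment y1 y2"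
    using xseg yseg greaterThanLessThan_subseteq_atLeastAtMost_iff[of a b a b]
      greaterThanLessThan_subseteq_atLeastAtMost_iff[of c d c d] by blast+
  have ft: "((\<lambda>t. f (t, v)) has_real_derivative partial_t \<Delta> f (u, v)) (at u)"
    if "u \<in> {a<..<b}" "v \<in> {c..d}" for u v
    using that f_diff[of v] unfolding \<Delta>
    by (intro partial_t_works) (auto simp: differentiable_on_eq_differentiable_at)
  have fs: "((\<lambda>s. f (u, s)) has_real_derivative partial_s \<Delta> f (u, v)) (at v)"
    if "u \<in> {a<..<b}" "v \<in> {c<..<d}" for u v
    using that fs_exists[of u] unfolding \<Delta>
    by (intro partial_s_works) (auto simp: differentiable_on_eq_differentiable_at)
  have fts: "((\<lambda>s. partial_t \<Delta> f (u, s)) has_real_derivative partial_ts \<Delta> f (u, v)) (at v)"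
    if "u \<in> {a<..<b}" "v \<in> {c<..<d}" for u v
    using that fx_diff[of u] unfolding \<Delta> partial_ts_def
    by (intro partial_s_works) (auto simp: differentiable_on_eq_differentiable_at)

  define G where "G u = (y2 * f (u, y1) - y1 * f (u, y2)) / (y2 - y1)" for u
  define G' where "G' u = (y2 * partial_t \<Delta> f (u, y1) - y1 * partial_t \<Delta> f (u, y2)) / (y2 - y1)" for u
  have "\<exists>\<xi> \<in> open_segment x1 x2. (x2 * G x1 - x1 * G x2) / (x2 - x1) = G \<xi> - \<xi> * G' \<xi>"
  proof (rule pompeiu_mean_value[OF \<open>x1 \<noteq> x2\<close> nz_seg(1)])
    show "(G has_real_derivative G' u) (at u)" if "u \<in> closed_segment x1 x2" for u
      unfolding G_def G'_def using that xseg y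
      by (intro DERIV_cdivide DERIV_diff DERIV_cmult ft) auto
  qed
  then obtain \<xi>1 where \<xi>1: "\<xi>1 \<in> open_segment x1 x2"
    and G: "(x2 * G x1 - x1 * G x2) / (x2 - x1) = G \<xi>1 - \<xi>1 * G' \<xi>1"
    by blast
  have \<xi>1_in: "\<xi>1 \<in> {a<..<b}"
    using \<xi>1 xseg segment_open_subset_closed by blast

  define H where "H v = f (\<xi>1, v) - \<xi>1 * partial_t \<Delta> f (\<xi>1, v)" for v
  define H' where "H' v = partial_s \<Delta> f (\<xi>1, v) - \<xi>1 * partial_ts \<Delta> f (\<xi>1, v)" for v
  have "\<exists>\<xi> \<in> open_segment y1 y2. (y2 * H y1 - y1 * H y2) / (y2 - y1) = H \<xi> - \<xi> * H' \<xi>"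
  proof (rule pompeiu_mean_value[OF \<open>y1 \<noteq> y2\<close> nz_seg(2)])
    show "(H has_real_derivative H' v) (at v)" if "v \<in> closed_segment y1 y2" for v
      unfolding H_def H'_def using that yseg \<xi>1_in
      by (intro DERIV_diff DERIV_cmult fs fts) auto
  qed
  then obtain \<xi>2 where \<xi>2: "\<xi>2 \<in> open_segment y1 y2"
    and H: "(y2 * H y1 - y1 * H y2) / (y2 - y1) = H \<xi>2 - \<xi>2 * H' \<xi>2"
    by blast

  have "\<xi>1 * \<xi>2 * partial_ts \<Delta> f (\<xi>1, \<xi>2) - \<xi>1 * partial_t \<Delta> f (\<xi>1, \<xi>2)
        - \<xi>2 * partial_s \<Delta> f (\<xi>1, \<xi>2) + f (\<xi>1, \<xi>2) = H \<xi>2 - \<xi>2 * H' \<xi>2"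
    by (simp add: H_def H'_def algebra_simps)
  also have "\<dots> = G \<xi>1 - \<xi>1 * G' \<xi>1"
    unfolding H[symmetric] using y
    by (simp add: G_def G'_def H_def divide_simps) (simp add: algebra_simps)
  also have "\<dots> = (x2 * y2 * f (x1, y1) - x2 * y1 * f (x1, y2)
          - x1 * y2 * f (x2, y1) + x1 * y1 * f (x2, y2)) / ((x2 - x1) * (y2 - y1))"
    unfolding G[symmetric] using x y
    by (simp add: G_def divide_simps) (simp add: algebra_simps)
  finally show "\<exists>\<xi>1 \<in> open_segment x1 x2. \<exists>\<xi>2 \<in> open_segment y1 y2.
      \<xi>1 * \<xi>2 * partial_ts \<Delta> f (\<xi>1, \<xi>2) - \<xi>1 * partial_t \<Delta> f (\<xi>1, \<xi>2)
        - \<xi>2 * partial_s \<Delta> f (\<xi>1, \<xi>2) + f (\<xi>1, \<xi>2)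
      = (x2 * y2 * f (x1, y1) - x2 * y1 * f (x1, y2)
          - x1 * y2 * f (x2, y1) + x1 * y1 * f (x2, y2))
        / ((x2 - x1) * (y2 - y1))"
    using \<xi>1 \<xi>2 by blast
qed

end
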